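(* Let $A$ be an invertible $n\times n$ matrix over a field $\mathbb{F}$, let $0\le i\le n$, let $k$ be a positive integer with $0\le ik\le n$, and let $\mathbf{I}=(\mathbf{I}_1,\dots,\mathbf{I}_k)$ and $\mathbf{J}=(\mathbf{J}_1,\dots,\mathbf{J}_k)$ be increasingly ordered $k$-tuples of $i$-tuples of distinct indices in $\{1,\dots,n\}$, so that $A_{\mathbf{I},\mathbf{J}}$ is an $ik\times ik$ submatrix of $A$. Then $$[\mathrm{adj}_i(A)_{\mathbf{I},\mathbf{J}}]=C_{\mathbf{J},\mathbf{I}}\,\det(A)^{k-1}.$$
   Context: $n\ge 2$, $N=\{1,\dots,n\}$, and $V$ is an $n$-dimensional $\mathbb{F}$-vector space with basis $\hat e_1,\dots,\hat e_n$, orthonormal for the bilinear form $\langle\hat e_i,\hat e_j\rangle=\delta_{ij}$. For $\alpha\in N^i$, $\hat e_\alpha=\hat e_{\alpha_1}\otimes\cdots\otimes\hat e_{\alpha_i}$, and $\{\hat e_\alpha\}$ is an orthonormal basis of $V^{\otimes i}$. A multilinear transformation $\mathbf{A}:V^{\otimes i}\to V^{\otimes i}$ has coefficients $(\mathbf{A})_{\alpha,\beta}=\langle\hat e_\alpha,\mathbf{A}\hat e_\beta\rangle$ for $\alpha,\beta\in N^i$. An ordered subset of $N$ is a strictly increasing tuple of elements of $N$. For ordered subsets $I=(I_1,\dots,I_r)$ and $J=(J_1,\dots,J_r)$, $A_{I,J}$ is the submatrix of $A$ with rows $I$ and columns $J$; $[A^c_{I,J}]$ is the determinant of the submatrix obtained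 by deleting the rows in $I$ and the columns in $J$ (the empty determinant is $1$); and the $(I,J)$-cofactor of $A$ is $C_{I,J}=(-1)^{I_1+\cdots+I_r+J_1+\cdots+J_r}[A^c_{I,J}]$. The $i$-adjugate of $A$ is the multilinear transformation $\mathrm{adj}_i(A):V^{\otimes i}\to V^{\otimes i}$ whose coefficients are the general cofactors $(\mathrm{adj}_i(A))_{I,J}=C_{J,I}$ for ordered subsets $I,J$ of $N$ with $i$ elements. It is identified with a map that is antisymmetric in its inputs and in its outputs; that is, $(\mathrm{adj}_i(A))_{\alpha,\beta}$ changes sign when two entries of $\alpha$, or two entries of $\beta$, are interchanged, and is $0$ when $\alpha$ or $\beta$ has a repeated entry. Here $\mathbf{I}_j=(I_{j,1},\dots,I_{j,i})$, with all entries of $\mathbf{I}$ distinct and $1\le I_{1,1}\le\cdots\le I_{1,i}\le\cdots\le I_{k,1}\le\cdots\le I_{k,i}\le n$, and similarly for $\mathbf{J}$. In $A_{\mathbf{I},\mathbf{J}}$ and $C_{\mathbf{J},\mathbf{I}}$, the families $\mathbf{I},\mathbf{J}$ are regarded, by concatenation, as ordered subsets of $N$ with $ik$ elements. For a multilinear transformation $\mathbf{A}:V^{\otimes i}\to V^{\otimes i}$, the $\mathbf{I},\mathbf{J}$-minor is $$[\mathbf{A}_{\mathbf{I},\mathbf{J}}]=\sum_{\sigma\in S_{ik}}\mathrm{sgn}(\sigma)\,(\mathbf{A})_{\mathbf{I}_1,\sigma(\mathbf{J}_1)}(\mathbf{A})_{\mathbf{I}_2,\sigma(\mathbf{J}_2)}\cdots(\mathbf{A})_{\mathbf{I}_k,\sigma(\mathbf{J}_k)},$$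 where $S_{ik}$ is the group of permutations of $\{1,\dots,ik\}$ and, writing $\mathbf{J}$ as a concatenated tuple $(J_1,\dots,J_{ik})$, $\sigma(\mathbf{J}_j)=(J_{\sigma((j-1)i+1)},\dots,J_{\sigma(ji)})$.
   Formalization: As stated the identity is off by a factor (i!)^k (fails for n=i=2, k=1, A=identity: 2 versus 1); proved instead: the S_ik-minor equals (i!)^k C_{J,I} det(A)^{k-1}, and the stated formula holds when only permutations increasing on each block are summed. *)

theory Defs
  imports
    "Jordan_Normal_Form.Determinant"
    "Jordan_Normal_Form.DL_Submatrix"
begin

(* Indices run over N = {0, ..., n - 1}, as for JNF matrices, instead of {1, ..., n}; tuples of
   indices are lists.  An ordered subset of N is a strictly increasing list. *)

definition index_tuples :: "nat \<Rightarrow> nat \<Rightarrow> nat list set" where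
  "index_tuples n i = {\<alpha>. length \<alpha> = i \<and> set \<alpha> \<subseteq> {..<n}}"

(* The exponent may be computed with 0-based indices: for two subsets of size r the shift to
   1-based indices changes it by 2 r. *)
definition gen_cofactor :: "'a :: comm_ring_1 mat \<Rightarrow> nat list \<Rightarrow> nat list \<Rightarrow> 'a" where
  "gen_cofactor A I J =
     (- 1) ^ (sum_list I + sum_list J) * det (submatrix A (- set I) (- set J))"

(* An element of the i-th tensor power of V is given by its coordinates in the basis
   (e_\<alpha>), \<alpha> in N^i. *)
type_synonym 'a tensor = "nat list \<Rightarrow> 'a"

definition tensor_basis :: "nat list \<Rightarrow> 'a :: comm_ring_1 tensor" where
  "tensor_basis \<alpha> = (\<lambda>\<gamma>. if \<gamma> = \<alpha> then 1 else 0)"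

definition tensor_form :: "nat \<Rightarrow> nat \<Rightarrow> 'a :: comm_ring_1 tensor \<Rightarrow> 'a tensor \<Rightarrow> 'a" where
  "tensor_form n i u v = (\<Sum>\<gamma>\<in>index_tuples n i. u \<gamma> * v \<gamma>)"

definition tensor_coeff ::
    "nat \<Rightarrow> nat \<Rightarrow> ('a :: comm_ring_1 tensor \<Rightarrow> 'a tensor) \<Rightarrow> nat list \<Rightarrow> nat list \<Rightarrow> 'a" where
  "tensor_coeff n i T \<alpha> \<beta> = tensor_form n i (tensor_basis \<alpha>) (T (tensor_basis \<beta>))"

definition tensor_map ::
    "nat \<Rightarrow> nat \<Rightarrow> (nat list \<Rightarrow> nat list \<Rightarrow> 'a :: comm_ring_1) \<Rightarrow> 'a tensor \<Rightarrow> 'a tensor" where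
  "tensor_map n i c v =
     (\<lambda>\<alpha>. if \<alpha> \<in> index_tuples n i then \<Sum>\<beta>\<in>index_tuples n i. c \<alpha> \<beta> * v \<beta> else 0)"

(* The extension of a family indexed by pairs of ordered subsets of size i to all i-tuples which is
   antisymmetric in both arguments.  Exactly one pair of permutations contributes if \<alpha> and
   \<beta> are both distinct, and none otherwise; see the antisym_extension lemmas below. *)
definition antisym_extension ::
    "nat \<Rightarrow> (nat list \<Rightarrow> nat list \<Rightarrow> 'a :: comm_ring_1) \<Rightarrow> nat list \<Rightarrow> nat list \<Rightarrow> 'a" where
  "antisym_extension i c \<alpha> \<beta> =
     (\<Sum>\<pi> | \<pi> permutes {..<i} \<and> sorted_wrt (<) (permute_list \<pi> \<alpha>).
      \<Sum>\<rho> | \<rho> permutes {..<i} \<and> sorted_wrt (<) (permute_list \<rho> \<beta>).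
        of_int (sign \<pi> * sign \<rho>) * c (permute_list \<pi> \<alpha>) (permute_list \<rho> \<beta>))"

definition adjugate :: "nat \<Rightarrow> nat \<Rightarrow> 'a :: comm_ring_1 mat \<Rightarrow> 'a tensor \<Rightarrow> 'a tensor" where
  "adjugate n i A = tensor_map n i (antisym_extension i (\<lambda>I J. gen_cofactor A J I))"

definition increasing_family :: "nat \<Rightarrow> nat \<Rightarrow> nat \<Rightarrow> nat list list \<Rightarrow> bool" where
  "increasing_family n i k I \<longleftrightarrow>
     length I = k \<and> (\<forall>\<alpha>\<in>set I. \<alpha> \<in> index_tuples n i) \<and> sorted_wrt (<) (concat I)"

definition permuted_block :: "nat \<Rightarrow> (nat \<Rightarrow> nat) \<Rightarrow> nat list list \<Rightarrow> nat \<Rightarrow> nat list" where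
  "permuted_block i \<sigma> J j = map (\<lambda>m. concat J ! \<sigma> m) [j * i..<Suc j * i]"

definition minor_term ::
    "nat \<Rightarrow> nat \<Rightarrow> nat \<Rightarrow> ('a :: comm_ring_1 tensor \<Rightarrow> 'a tensor) \<Rightarrow> nat list list \<Rightarrow> nat list list
       \<Rightarrow> (nat \<Rightarrow> nat) \<Rightarrow> 'a" where
  "minor_term n i k T I J \<sigma> =
     of_int (sign \<sigma>) * (\<Prod>j<k. tensor_coeff n i T (I ! j) (permuted_block i \<sigma> J j))"

definition tensor_minor ::
    "nat \<Rightarrow> nat \<Rightarrow> nat \<Rightarrow> ('a :: comm_ring_1 tensor \<Rightarrow> 'a tensor) \<Rightarrow> nat list list \<Rightarrow> nat list list
       \<Rightarrow> 'a" where
  "tensor_minor n i k T I J = (\<Sum>\<sigma> | \<sigma> permutes {..<i * k}. minor_term n i k T I J \<sigma>)"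

(* For T antisymmetric in its inputs, minor_term depends only on the class of \<sigma> modulo the
   (fact i) ^ k permutations that preserve each of the k blocks of length i.  Here every class is
   counted once, through its member that is increasing on each block. *)
definition reduced_tensor_minor ::
    "nat \<Rightarrow> nat \<Rightarrow> nat \<Rightarrow> ('a :: comm_ring_1 tensor \<Rightarrow> 'a tensor) \<Rightarrow> nat list list \<Rightarrow> nat list list
       \<Rightarrow> 'a" where
  "reduced_tensor_minor n i k T I J =
     (\<Sum>\<sigma> | \<sigma> permutes {..<i * k} \<and> (\<forall>j<k. strict_mono_on {j * i..<Suc j * i} \<sigma>).
        minor_term n i k T I J \<sigma>)"

lemma finite_index_tuples: "finite (index_tuples n i)"
proof -
  have "index_tuples n i = {\<alpha>. set \<alpha> \<subseteq> {..<n} \<and> length \<alpha> = i}"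
    by (auto simp: index_tuples_def)
  then show ?thesis
    using finite_lists_length_eq[of "{..<n}" i] by simp
qed

lemma tensor_coeff_tensor_map:
  assumes "\<alpha> \<in> index_tuples n i" "\<beta> \<in> index_tuples n i"
  shows "tensor_coeff n i (tensor_map n i c) \<alpha> \<beta> = c \<alpha> \<beta>"
  using assms finite_index_tuples[of n i]
  by (simp add: tensor_coeff_def tensor_form_def tensor_basis_def tensor_map_def
      if_distrib[of "\<lambda>x. x * _"] if_distrib[of "\<lambda>x. _ * x"] sum.delta sum.delta' cong: if_cong)

lemma sorted_permute_list_iff_id:
  assumes "sorted_wrt (<) (\<alpha> :: nat list)" "\<pi> permutes {..<length \<alpha>}"
  shows "sorted_wrt (<) (permute_list \<pi> \<alpha>) \<longleftrightarrow> \<pi> = id"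
proof
  assume s: "sorted_wrt (<) (permute_list \<pi> \<alpha>)"
  have "permute_list \<pi> \<alpha> = \<alpha>"
    using s assms by (metis mset_permute_list properties_for_sort sort_key_id_if_sorted
        strict_sorted_iff sorted_sort_id)
  moreover have "distinct \<alpha>"
    using assms(1) strict_sorted_iff by blast
  ultimately have "\<pi> m = m" if "m < length \<alpha>" for m
    using that assms(2) permute_list_nth[OF assms(2) that]
    by (metis lessThan_iff nth_eq_iff_index_eq permutes_in_image)
  then show "\<pi> = id"
    using assms(2) by (metis eq_id_iff lessThan_iff permutes_not_in)
qed (use assms in simp)

lemma antisym_extension_ordered:
  assumes "sorted_wrt (<) \<alpha>" "length \<alpha> = i" "sorted_wrt (<) \<beta>" "length \<beta> = i"
  shows "antisym_extension i c \<alpha> \<beta> = c \<alpha> \<beta>"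
proof -
  have "{\<pi>. \<pi> permutes {..<i} \<and> sorted_wrt (<) (permute_list \<pi> \<gamma>)} = {id}"
    if "sorted_wrt (<) \<gamma>" "length \<gamma> = i" for \<gamma> :: "nat list"
    using that sorted_permute_list_iff_id[of \<gamma>] permutes_id[of "{..<i}"] by auto
  then show ?thesis
    using assms by (simp add: antisym_extension_def)
qed

lemma antisym_extension_repeated:
  assumes "length \<alpha> = i" "length \<beta> = i" "\<not> distinct \<alpha> \<or> \<not> distinct \<beta>"
  shows "antisym_extension i c \<alpha> \<beta> = 0"
proof -
  have e: "{\<pi>. \<pi> permutes {..<i} \<and> sorted_wrt (<) (permute_list \<pi> \<gamma>)} = {}"
    if "\<not> distinct \<gamma>" "length \<gamma> = i" for \<gamma> :: "nat list"
    using that strict_sorted_iff distinct_permute_list by blast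
  have "{\<pi>. \<pi> permutes {..<i} \<and> sorted_wrt (<) (permute_list \<pi> \<alpha>)} = {} \<or>
      {\<pi>. \<pi> permutes {..<i} \<and> sorted_wrt (<) (permute_list \<pi> \<beta>)} = {}"
    using assms(3) e[OF _ assms(1)] e[OF _ assms(2)] by blast
  then show ?thesis
    by (elim disjE) (simp_all only: antisym_extension_def sum.empty sum.neutral_const)
qed

lemma bij_betw_sorting_permutations:
  assumes "\<tau> permutes {..<i}" "length (\<alpha> :: nat list) = i"
  shows "bij_betw (\<lambda>\<pi>. \<tau> \<circ> \<pi>)
     {\<pi>. \<pi> permutes {..<i} \<and> sorted_wrt (<) (permute_list \<pi> (permute_list \<tau> \<alpha>))}
     {\<pi>. \<pi> permutes {..<i} \<and> sorted_wrt (<) (permute_list \<pi> \<alpha>)}"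
proof (rule bij_betw_byWitness[where f' = "\<lambda>\<pi>. inv_into UNIV \<tau> \<circ> \<pi>"])
  have c: "permute_list \<pi> (permute_list \<tau> \<alpha>) = permute_list (\<tau> \<circ> \<pi>) \<alpha>"
    if "\<pi> permutes {..<i}" for \<pi>
    using that assms permute_list_compose[of \<pi> \<alpha> \<tau>] by simp
  have e: "\<tau> \<circ> (inv_into UNIV \<tau> \<circ> \<pi>) = \<pi>" "inv_into UNIV \<tau> \<circ> (\<tau> \<circ> \<pi>) = \<pi>" for \<pi> :: "nat \<Rightarrow> nat"
    using permutes_inv_o[OF assms(1)] by (simp_all add: o_assoc)
  have p: "(\<tau> \<circ> \<pi>) permutes {..<i}" "(inv_into UNIV \<tau> \<circ> \<pi>) permutes {..<i}"
    if "\<pi> permutes {..<i}" for \<pi>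
    using that assms(1) permutes_compose permutes_inv by blast+
  show "\<forall>\<pi>\<in>{\<pi>. \<pi> permutes {..<i} \<and> sorted_wrt (<) (permute_list \<pi> (permute_list \<tau> \<alpha>))}.
      inv_into UNIV \<tau> \<circ> (\<tau> \<circ> \<pi>) = \<pi>"
    using e by simp
  show "\<forall>\<pi>\<in>{\<pi>. \<pi> permutes {..<i} \<and> sorted_wrt (<) (permute_list \<pi> \<alpha>)}.
      \<tau> \<circ> (inv_into UNIV \<tau> \<circ> \<pi>) = \<pi>"
    using e by simp
  show "(\<lambda>\<pi>. \<tau> \<circ> \<pi>) `
      {\<pi>. \<pi> permutes {..<i} \<and> sorted_wrt (<) (permute_list \<pi> (permute_list \<tau> \<alpha>))}
      \<subseteq> {\<pi>. \<pi> permutes {..<i} \<and> sorted_wrt (<) (permute_list \<pi> \<alpha>)}"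
    using c p(1) by auto
  show "(\<lambda>\<pi>. inv_into UNIV \<tau> \<circ> \<pi>) ` {\<pi>. \<pi> permutes {..<i} \<and> sorted_wrt (<) (permute_list \<pi> \<alpha>)}
      \<subseteq> {\<pi>. \<pi> permutes {..<i} \<and> sorted_wrt (<) (permute_list \<pi> (permute_list \<tau> \<alpha>))}"
    using c p(2) e(1) by auto
qed

lemma sign_mult_sign_compose:
  assumes "\<tau> permutes {..<i :: nat}" "\<pi> permutes {..<i}"
  shows "sign \<tau> * sign (\<tau> \<circ> \<pi>) = sign \<pi>"
proof -
  have "sign (\<tau> \<circ> \<pi>) = sign \<tau> * sign \<pi>"
    using assms by (intro sign_compose) (auto intro: permutes_imp_permutation)
  then show ?thesis
    by (simp add: sign_def)
qed

lemma antisym_extension_permute_left: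
  assumes "\<tau> permutes {..<i}" "length \<alpha> = i"
  shows "antisym_extension i c (permute_list \<tau> \<alpha>) \<beta>
    = of_int (sign \<tau>) * antisym_extension i c \<alpha> \<beta>"
  unfolding antisym_extension_def sum_distrib_left
proof (subst sum.reindex_bij_betw[OF bij_betw_sorting_permutations[OF assms], symmetric],
    intro sum.cong refl)
  fix \<pi> \<rho> :: "nat \<Rightarrow> nat"
  assume "\<pi> \<in> {\<pi>. \<pi> permutes {..<i} \<and> sorted_wrt (<) (permute_list \<pi> (permute_list \<tau> \<alpha>))}"
  then have \<pi>: "\<pi> permutes {..<i}" by simp
  have "permute_list \<pi> (permute_list \<tau> \<alpha>) = permute_list (\<tau> \<circ> \<pi>) \<alpha>"
    using \<pi> assms permute_list_compose[of \<pi> \<alpha> \<tau>] by simp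
  moreover have "sign \<pi> * sign \<rho> = sign \<tau> * (sign (\<tau> \<circ> \<pi>) * sign \<rho>)"
    using sign_mult_sign_compose[OF assms(1) \<pi>] by (simp add: mult.assoc[symmetric])
  ultimately show "of_int (sign \<pi> * sign \<rho>) *
       c (permute_list \<pi> (permute_list \<tau> \<alpha>)) (permute_list \<rho> \<beta>) =
     of_int (sign \<tau>) * (of_int (sign (\<tau> \<circ> \<pi>) * sign \<rho>) *
       c (permute_list (\<tau> \<circ> \<pi>) \<alpha>) (permute_list \<rho> \<beta>))"
    by (simp add: mult.assoc[symmetric] flip: of_int_mult)
qed

lemma antisym_extension_swap:
  "antisym_extension i c \<alpha> \<beta> = antisym_extension i (\<lambda>I J. c J I) \<beta> \<alpha>"
  unfolding antisym_extension_def by (subst sum.swap) (simp add: mult.commute)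

lemma antisym_extension_permute_right:
  assumes "\<tau> permutes {..<i}" "length \<beta> = i"
  shows "antisym_extension i c \<alpha> (permute_list \<tau> \<beta>)
    = of_int (sign \<tau>) * antisym_extension i c \<alpha> \<beta>"
  using antisym_extension_permute_left[OF assms, of "\<lambda>I J. c J I" \<alpha>]
  by (simp add: antisym_extension_swap[of i c])

(* [adj_i(A)_{I,J}] = C_{J,I} det(A)^(k-1) fails for tensor_minor when i >= 2, already for n = i = 2,
   k = 1 and A = 1: summing over the whole of S_{ik} repeats each term (fact i) ^ k times. *)
lemma tensor_minor_adjugate_one:
  "tensor_minor 2 2 1 (adjugate 2 2 (1\<^sub>m 2 :: 'a :: field mat)) [[0, 1]] [[0, 1]] = 2"
  "gen_cofactor (1\<^sub>m 2 :: 'a mat) [0, 1] [0, 1] * det (1\<^sub>m 2) ^ (1 - 1) = (1 :: 'a)"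
proof -
  have dim: "dim_row (submatrix (1\<^sub>m 2 :: 'a mat) (- set [0, 1]) (- set [0, 1])) = 0"
      "dim_col (submatrix (1\<^sub>m 2 :: 'a mat) (- set [0, 1]) (- set [0, 1])) = 0"
    by (auto simp: dim_submatrix less_2_cases_iff)
  have "det (submatrix (1\<^sub>m 2 :: 'a mat) (- set [0, 1]) (- set [0, 1])) = 1"
    by (rule det_dim_zero) (use dim in \<open>rule carrier_matI\<close>)
  then have C: "gen_cofactor (1\<^sub>m 2 :: 'a mat) [0, 1] [0, 1] = 1"
    unfolding gen_cofactor_def by simp
  then show "gen_cofactor (1\<^sub>m 2 :: 'a mat) [0, 1] [0, 1] * det (1\<^sub>m 2) ^ (1 - 1) = (1 :: 'a)"
    by simp
  let ?c = "antisym_extension 2 (\<lambda>I J. gen_cofactor (1\<^sub>m 2 :: 'a mat) J I)"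
  have c1: "?c [0, 1] [0, 1] = 1"
    using C by (simp add: antisym_extension_ordered)
  have "minor_term 2 2 1 (adjugate 2 2 (1\<^sub>m 2 :: 'a mat)) [[0, 1]] [[0, 1]] \<sigma> = 1"
    if \<sigma>: "\<sigma> permutes {..<2}" for \<sigma>
  proof -
    have b: "permuted_block 2 \<sigma> [[0, 1]] 0 = permute_list \<sigma> [0, 1]"
      by (simp add: permuted_block_def permute_list_def numeral_2_eq_2)
    have "permute_list \<sigma> [0, 1] \<in> index_tuples 2 2"
      using \<sigma> set_permute_list[of \<sigma> "[0, 1 :: nat]"] by (simp add: index_tuples_def numeral_2_eq_2)
    then have "tensor_coeff 2 2 (adjugate 2 2 (1\<^sub>m 2 :: 'a mat)) [0, 1] (permute_list \<sigma> [0, 1])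
        = ?c [0, 1] (permute_list \<sigma> [0, 1])"
      unfolding adjugate_def by (intro tensor_coeff_tensor_map) (auto simp: index_tuples_def)
    also have "\<dots> = of_int (sign \<sigma>)"
      by (subst antisym_extension_permute_right[OF \<sigma>]) (simp_all only: c1, simp_all)
    finally show ?thesis
      using b by (simp add: minor_term_def sign_def)
  qed
  then have "tensor_minor 2 2 1 (adjugate 2 2 (1\<^sub>m 2 :: 'a mat)) [[0, 1]] [[0, 1]]
      = of_nat (card {\<sigma>. \<sigma> permutes {..<2 :: nat}})"
    by (simp add: tensor_minor_def)
  also have "card {\<sigma>. \<sigma> permutes {..<2 :: nat}} = 2"
    using card_permutations[of "{..<2 :: nat}" 2] by simp
  finally show "tensor_minor 2 2 1 (adjugate 2 2 (1\<^sub>m 2 :: 'a mat)) [[0, 1]] [[0, 1]] = 2"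
    by simp
qed

end

(* By Jacobi's identity, C_{J,I} = det(A) det(B_{I,J}) for the inverse B of A, so the coefficients of
   adj_i(A) are, up to the factor det(A), the i x i minors of B.  The Laplace expansion of
   det(B_{I,J}) along k blocks of i rows then turns the reduced minor into det(A)^k det(B_{I,J}).
   It rests on the unique factorization of a permutation in S_{ik} into one that is increasing on
   each block after one that preserves each block; the same factorization, with the antisymmetry of
   adj_i(A), makes the full minor (i!)^k times the reduced one. *)

theory Submission
  imports Defs
begin

section \<open>Counting and picking in ordered index sets and their complements\<close>

lemma pick_eqI:
  assumes "y \<in> S" "card {x \<in> S. x < y} = a"
  shows "pick S a = y"
  using pick_card_in_set[OF assms(1)] assms(2) by simp

lemma card_less_nth_sorted:
  fixes I :: "'a :: linorder list"
  assumes "sorted_wrt (<) I" "b < length I"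
  shows "card {x \<in> set I. x < I ! b} = b"
proof -
  have d: "distinct I" using assms(1) strict_sorted_iff by blast
  have "{x \<in> set I. x < I ! b} = (!) I ` {..<b}"
  proof (intro equalityI subsetI)
    fix x assume "x \<in> {x \<in> set I. x < I ! b}"
    then obtain c where c: "c < length I" "x = I ! c" "I ! c < I ! b"
      by (auto simp: in_set_conv_nth)
    have "c < b"
      using c assms sorted_wrt_nth_less[OF assms(1), of b c]
      by (metis linorder_neqE_nat order_less_asym order_less_irrefl)
    then show "x \<in> (!) I ` {..<b}" using c by simp
  next
    fix x assume "x \<in> (!) I ` {..<b}"
    then show "x \<in> {x \<in> set I. x < I ! b}"
      using assms sorted_wrt_nth_less[OF assms(1)] by auto
  qed
  moreover have "inj_on ((!) I) {..<b}"
    using d assms(2) by (auto simp: inj_on_def nth_eq_iff_index_eq)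
  ultimately show ?thesis by (simp add: card_image)
qed

lemma card_less_Compl:
  assumes "K \<subseteq> {..<n :: nat}"
  shows "card {x. x < n \<and> x \<in> - K} = n - card K"
proof -
  have "{x. x < n \<and> x \<in> - K} = {..<n} - K" by auto
  then show ?thesis
    using assms by (simp add: card_Diff_subset finite_subset)
qed

text \<open>\<open>insert_index m\<close> is the order isomorphism from the natural numbers onto
  those different from \<open>m\<close>. As \<open>K\<close> lies below \<open>m\<close>, it carries
  \<open>- K\<close> onto \<open>- insert m K\<close>, and an order isomorphism sends the element in
  position \<open>a\<close> to the element in position \<open>a\<close>.\<close>

lemma pick_Compl_insert:
  assumes "K \<subseteq> {..<m}"
  shows "pick (- insert m K) a = insert_index m (pick (- K) a)"
proof -
  have fin: "finite K" using assms finite_subset by blast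
  then have inf: "infinite (- K)" by simp
  define y where "y = pick (- K) a"
  have yK: "y \<notin> K" using pick_in_set_inf[OF inf, of a] by (simp add: y_def)
  have ya: "card {x \<in> - K. x < y} = a" using card_pick_inf[OF inf] by (simp add: y_def)
  have "{x \<in> - insert m K. x < insert_index m y} = insert_index m ` {x \<in> - K. x < y}"
  proof (intro equalityI subsetI)
    fix x assume x: "x \<in> {x \<in> - insert m K. x < insert_index m y}"
    show "x \<in> insert_index m ` {x \<in> - K. x < y}"
    proof (cases "x < m")
      case True
      then have "x = insert_index m x" "x < y" "x \<notin> K"
        using x by (auto simp: insert_index_def split: if_splits)
      then show ?thesis by blast
    next
      \<comment> \<open>Here \<open>x > m\<close>, so the preimage is \<open>x - 1 \<ge> m\<close>,
        which avoids \<open>K\<close> because \<open>K\<close> lies below \<open>m\<close>.\<close>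
      case False
      then have "x = insert_index m (x - 1)" "x - 1 < y" "x - 1 \<notin> K"
        using x assms by (auto simp: insert_index_def split: if_splits)
      then show ?thesis by blast
    qed
  next
    fix x assume "x \<in> insert_index m ` {x \<in> - K. x < y}"
    then show "x \<in> {x \<in> - insert m K. x < insert_index m y}"
      using assms by (auto simp: insert_index_def split: if_splits)
  qed
  moreover have "inj_on (insert_index m) {x \<in> - K. x < y}"
    by (auto simp: inj_on_def insert_index_def split: if_splits)
  ultimately have "card {x \<in> - insert m K. x < insert_index m y} = a"
    by (simp only: card_image ya)
  moreover have "insert_index m y \<in> - insert m K"
    using yK assms by (auto simp: insert_index_def)
  ultimately show ?thesis unfolding y_def[symmetric] by (intro pick_eqI)
qed

section \<open>Determinants with unit columns and Jacobi's identity\<close>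

lemma submatrix_UNIV: "submatrix M UNIV UNIV = M"
  by (rule eq_matI) (auto simp: submatrix_def pick_UNIV)

text \<open>Deleting the largest row and column first leaves the smaller indices in \<open>P\<close>
  and \<open>Q\<close> with their old numbers, so no renumbering occurs. This identifies the
  remaining submatrix in the induction over unit columns.\<close>

lemma submatrix_mat_delete:
  assumes M: "M \<in> carrier_mat (Suc l) (Suc l)" and "p \<le> l" "q \<le> l"
    and "P \<subseteq> {..<p}" "Q \<subseteq> {..<q}"
  shows "submatrix (mat_delete M p q) (- P) (- Q) = submatrix M (- insert p P) (- insert q Q)"
proof -
  have c: "card {x. x < Suc l \<and> x \<in> - insert s S} = card {x. x < l \<and> x \<in> - S}"
    if "S \<subseteq> {..<s}" "s \<le> l" for s and S :: "nat set"
  proof -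
    have "finite S" "s \<notin> S" using that finite_subset by blast+
    moreover have "S \<subseteq> {..<l}" "insert s S \<subseteq> {..<Suc l}" using that by auto
    ultimately show ?thesis using card_less_Compl[of S l] card_less_Compl[of "insert s S" "Suc l"] by simp
  qed
  have D: "mat_delete M p q \<in> carrier_mat l l" using mat_delete_carrier[OF M] by simp
  show ?thesis
  proof (rule eq_matI)
    fix a b
    assume "a < dim_row (submatrix M (- insert p P) (- insert q Q))"
      "b < dim_col (submatrix M (- insert p P) (- insert q Q))"
    then have ab: "a < card {x. x < l \<and> x \<in> - P}" "b < card {x. x < l \<and> x \<in> - Q}"
      using M assms c[of P p] c[of Q q] by (simp_all add: dim_submatrix)
    then have "pick (- P) a < l" "pick (- Q) b < l" by (simp_all add: pick_le)
    then have "mat_delete M p q $$ (pick (- P) a, pick (- Q) b)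
        = M $$ (pick (- insert p P) a, pick (- insert q Q) b)"
      using mat_delete_index[OF M, of p q] assms by (simp add: pick_Compl_insert)
    then show "submatrix (mat_delete M p q) (- P) (- Q) $$ (a, b)
        = submatrix M (- insert p P) (- insert q Q) $$ (a, b)"
      using ab M D assms c[of P p] c[of Q q] by (simp add: submatrix_index)
  qed (use M D assms c[of P p] c[of Q q] in \<open>simp_all add: dim_submatrix\<close>)
qed

text \<open>Induction on the number of unit columns, expanding along the last one: only row
  \<open>p\<close> contributes, with sign \<open>(- 1) ^ (p + q)\<close>, and these signs multiply
  up to the cofactor sign. Removing the indices from the largest down keeps the others in
  place.\<close>

lemma det_unit_columns:
  fixes M :: "'a :: comm_ring_1 mat"
  assumes "M \<in> carrier_mat n n" "sorted_wrt (<) I" "sorted_wrt (<) J" "length I = length J"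
    "set I \<subseteq> {..<n}" "set J \<subseteq> {..<n}"
    "\<And>x b. x < n \<Longrightarrow> b < length I \<Longrightarrow> M $$ (x, I ! b) = (if x = J ! b then 1 else 0)"
  shows "det M = (- 1) ^ (sum_list J + sum_list I) * det (submatrix M (- set J) (- set I))"
  using assms
proof (induction I arbitrary: J n M rule: rev_induct)
  case Nil
  then show ?case by (simp add: submatrix_UNIV)
next
  case (snoc q I)
  then obtain p J' where J: "J = J' @ [p]" by (metis length_append_singleton length_0_conv
        nat.distinct(1) rev_exhaust)
  note M = snoc.prems(1)
  from snoc.prems(5) obtain l where n: "n = Suc l" by (cases n) auto
  have pq: "p \<le> l" "q \<le> l" and P: "set J' \<subseteq> {..<p}" and Q: "set I \<subseteq> {..<q}"
    using snoc.prems J n by (auto simp: sorted_wrt_append)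
  have len: "length I = length J'" using snoc.prems(4) J by simp
  have col: "M $$ (x, q) = (if x = p then 1 else 0)" if "x < n" for x
    using snoc.prems(7)[OF that, of "length I"] by (simp add: J len nth_append)
  have "det M = (\<Sum>x<n. M $$ (x, q) * cofactor M x q)"
    using laplace_expansion_column[OF M] pq n by simp
  also have "\<dots> = (\<Sum>x<n. if x = p then cofactor M x q else 0)"
    using col by (intro sum.cong) auto
  also have "\<dots> = cofactor M p q" using pq n by simp
  finally have 1: "det M = (- 1) ^ (p + q) * det (mat_delete M p q)"
    by (simp add: cofactor_def)
  have "det (mat_delete M p q) = (- 1) ^ (sum_list J' + sum_list I)
      * det (submatrix (mat_delete M p q) (- set J') (- set I))"
  proof (rule snoc.IH)
    show "mat_delete M p q \<in> carrier_mat l l" using mat_delete_carrier[OF M] n by simp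
    show "sorted_wrt (<) I" "sorted_wrt (<) J'" "length I = length J'"
      using snoc.prems J by (auto simp: sorted_wrt_append)
    show "set I \<subseteq> {..<l}" "set J' \<subseteq> {..<l}" using P Q pq by auto
    fix x b assume xb: "x < l" "b < length I"
    then have Ib: "I ! b < q" "J' ! b < p" using P Q len nth_mem by (metis lessThan_iff subsetD)+
    \<comment> \<open>Since \<open>I ! b < q\<close> and \<open>J' ! b < p\<close>, the deletion
      shifts neither index, so the columns \<open>I\<close> of the smaller matrix are again unit
      vectors with their ones in the rows \<open>J'\<close>.\<close>
    have "mat_delete M p q $$ (x, I ! b) = M $$ (insert_index p x, insert_index q (I ! b))"
      using mat_delete_index[of M l p q x "I ! b"] M n pq xb Ib by simp
    also have "\<dots> = M $$ (insert_index p x, (I @ [q]) ! b)"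
      using Ib xb by (simp add: insert_index_def nth_append)
    also have "\<dots> = (if insert_index p x = J ! b then 1 else 0)"
      using xb n by (intro snoc.prems(7)) (auto simp: insert_index_def)
    also have "\<dots> = (if x = J' ! b then 1 else 0)"
      using xb Ib len J by (auto simp: insert_index_def nth_append)
    finally show "mat_delete M p q $$ (x, I ! b) = (if x = J' ! b then 1 else 0)" .
  qed
  also have "submatrix (mat_delete M p q) (- set J') (- set I) = submatrix M (- set J) (- set (I @ [q]))"
    using submatrix_mat_delete[of M l p q "set J'" "set I"] M n pq P Q J by simp
  finally show ?case using 1 J by (simp add: power_add ac_simps)
qed

text \<open>Jacobi's identity for complementary minors, read off from \<open>A * N\<close>, where \<open>N\<close> is the
  identity matrix with the columns \<open>I\<close> replaced by the columns \<open>J\<close> of the inverse.\<close>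

lemma gen_cofactor_eq_minor_inverse:
  fixes A B :: "'a :: comm_ring_1 mat"
  assumes A: "A \<in> carrier_mat n n" and B: "B \<in> carrier_mat n n" and AB: "A * B = 1\<^sub>m n"
    and I: "sorted_wrt (<) I" "set I \<subseteq> {..<n}" "length I = r"
    and J: "sorted_wrt (<) J" "set J \<subseteq> {..<n}" "length J = r"
  shows "gen_cofactor A J I = det A * det (mat r r (\<lambda>(a, b). B $$ (I ! a, J ! b)))"
proof -
  define N where "N = mat n n (\<lambda>(x, y). case map_of (zip I J) y of
      None \<Rightarrow> 1\<^sub>m n $$ (x, y) | Some z \<Rightarrow> B $$ (x, z))"
  have dI: "distinct I" using I(1) strict_sorted_iff by blast
  have N: "N \<in> carrier_mat n n" by (simp add: N_def)
  have Ilt: "I ! b < n" and Jlt: "J ! b < n" if "b < r" for b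
    using that I(2,3) J(2,3) by (metis lessThan_iff nth_mem subsetD)+
  have some: "map_of (zip I J) (I ! b) = Some (J ! b)" if "b < r" for b
    using that dI I J by (simp add: map_of_zip_nth)
  have none: "map_of (zip I J) y = None" if "y \<notin> set I" for y
    using that I J by simp
  have AN: "A * N \<in> carrier_mat n n" using A N by simp
  have M1: "(A * N) $$ (x, I ! b) = (if x = J ! b then 1 else 0)" if "x < n" "b < r" for x b
  proof -
    \<comment> \<open>Column \<open>I ! b\<close> of \<open>N\<close> is column \<open>J ! b\<close>
      of \<open>B\<close>, and \<open>A\<close> maps that column to a unit vector because
      \<open>A * B\<close> is the identity.\<close>
    have "col N (I ! b) = col B (J ! b)"
      using that B Ilt Jlt some by (intro eq_vecI) (auto simp: N_def)
    then have "(A * N) $$ (x, I ! b) = (A * B) $$ (x, J ! b)"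
      using that A B N Ilt Jlt by simp
    then show ?thesis using that Jlt by (simp add: AB)
  qed
  have M2: "(A * N) $$ (x, y) = A $$ (x, y)" if "x < n" "y < n" "y \<notin> set I" for x y
  proof -
    have "col N y = col (1\<^sub>m n) y"
      using that none[of y] by (intro eq_vecI) (auto simp: N_def)
    then have "(A * N) $$ (x, y) = (A * 1\<^sub>m n) $$ (x, y)"
      using that A N by (simp del: right_mult_one_mat)
    then show ?thesis using A by simp
  qed
  \<comment> \<open>Once the columns \<open>I\<close> are deleted, only columns in which
    \<open>A * N\<close> agrees with \<open>A\<close> remain.\<close>
  have sub: "submatrix (A * N) (- set J) (- set I) = submatrix A (- set J) (- set I)"
  proof (rule eq_matI)
    fix a b
    assume "a < dim_row (submatrix A (- set J) (- set I))"
      "b < dim_col (submatrix A (- set J) (- set I))"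
    then have ab: "a < card {x. x < n \<and> x \<in> - set J}" "b < card {x. x < n \<and> x \<in> - set I}"
      using A by (simp_all add: dim_submatrix)
    then have "pick (- set J) a < n" "pick (- set I) b < n" by (simp_all add: pick_le)
    moreover have "pick (- set I) b \<notin> set I"
      using pick_in_set_inf[of "- set I" b] by simp
    ultimately show "submatrix (A * N) (- set J) (- set I) $$ (a, b)
        = submatrix A (- set J) (- set I) $$ (a, b)"
      using ab A N M2 by (simp add: submatrix_index)
  qed (use A N in \<open>simp_all add: dim_submatrix\<close>)
  have "det (A * N) = (- 1) ^ (sum_list J + sum_list I)
      * det (submatrix (A * N) (- set J) (- set I))"
    using AN I J M1 by (intro det_unit_columns) auto
  then have 1: "gen_cofactor A J I = det A * det N"
    using det_mult[OF A N] by (simp add: gen_cofactor_def sub)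
  \<comment> \<open>The columns of \<open>N\<close> outside \<open>I\<close> are columns of the
    identity matrix. A second use of \<open>det_unit_columns\<close>, now with the complement
    \<open>K\<close> of \<open>I\<close> as both rows and columns, cuts \<open>det N\<close> down to
    the rows and columns \<open>I\<close>; the exponent of the sign is then even.\<close>
  define K where "K = filter (\<lambda>x. x \<notin> set I) [0..<n]"
  have K: "sorted_wrt (<) K" "set K \<subseteq> {..<n}"
    by (auto simp: K_def sorted_wrt_filter)
  have "N $$ (x, K ! b) = (if x = K ! b then 1 else 0)" if "x < n" "b < length K" for x b
  proof -
    have "K ! b \<notin> set I" "K ! b < n" using nth_mem[OF that(2)] by (auto simp: K_def)
    then show ?thesis using that none[of "K ! b"] by (simp add: N_def)
  qed
  then have "det N = (- 1) ^ (sum_list K + sum_list K) * det (submatrix N (- set K) (- set K))"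
    using N K by (intro det_unit_columns) auto
  then have 2: "det N = det (submatrix N (- set K) (- set K))"
    by (simp add: mult_2[symmetric] power_mult)
  have c: "card {x. x < n \<and> x \<in> - set K} = r"
  proof -
    have "{x. x < n \<and> x \<in> - set K} = set I" using I by (auto simp: K_def)
    then show ?thesis using distinct_card[OF dI] I by simp
  qed
  \<comment> \<open>The set \<open>- set K\<close> also contains every number from \<open>n\<close>
    on, but only its elements below \<open>I ! a < n\<close> are counted, and these lie in
    \<open>I\<close>.\<close>
  have pk: "pick (- set K) a = I ! a" if "a < r" for a
  proof (rule pick_eqI)
    show "I ! a \<in> - set K" using that I by (simp add: K_def)
    have "{x \<in> - set K. x < I ! a} = {x \<in> set I. x < I ! a}"
      using Ilt[OF that] by (auto simp: K_def)
    then show "card {x \<in> - set K. x < I ! a} = a"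
      using card_less_nth_sorted[OF I(1)] that I by simp
  qed
  have "submatrix N (- set K) (- set K) = mat r r (\<lambda>(a, b). B $$ (I ! a, J ! b))"
  proof (rule eq_matI)
    fix a b
    assume "a < dim_row (mat r r (\<lambda>(a, b). B $$ (I ! a, J ! b)))"
      "b < dim_col (mat r r (\<lambda>(a, b). B $$ (I ! a, J ! b)))"
    then have ab: "a < r" "b < r" by simp_all
    then have "submatrix N (- set K) (- set K) $$ (a, b) = N $$ (I ! a, I ! b)"
      using c N pk by (simp add: submatrix_index)
    also have "\<dots> = B $$ (I ! a, J ! b)"
      using ab Ilt some by (simp add: N_def)
    finally show "submatrix N (- set K) (- set K) $$ (a, b)
        = mat r r (\<lambda>(a, b). B $$ (I ! a, J ! b)) $$ (a, b)"
      using ab by simp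
  qed (use N c in \<open>simp_all add: dim_submatrix\<close>)
  then show ?thesis using 1 2 by simp
qed

section \<open>Block-preserving permutations and the factorization of permutations of
  \<open>{..<i * k}\<close>\<close>

text \<open>The embedding of a product of \<open>k\<close> copies of the symmetric group on
  \<open>{..<i}\<close> as the subgroup preserving each block of length \<open>i\<close>. Building
  it up one block at a time, instead of by division with remainder, gives its sign by induction on
  \<open>k\<close>.\<close>

primrec block_perm :: "nat \<Rightarrow> nat \<Rightarrow> (nat \<Rightarrow> nat \<Rightarrow> nat) \<Rightarrow> nat \<Rightarrow> nat" where
  "block_perm i 0 p = id"
| "block_perm i (Suc k) p = block_perm i k p \<circ> map_permutation {..<i} (\<lambda>m. k * i + m) (p k)"

lemma block_index_less:
  assumes "j < k" "m < i"
  shows "j * i + m < i * (k :: nat)"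
proof -
  have "j * i + m < Suc j * i" using assms by simp
  also have "\<dots> \<le> k * i" using assms by (intro mult_le_mono1) simp
  finally show ?thesis by (simp add: mult.commute)
qed

lemma block_indexE:
  assumes "x < i * (k :: nat)"
  obtains j m where "j < k" "m < i" "x = j * i + m"
proof
  have "i > 0" using assms by (cases i) auto
  then show "x div i < k" "x mod i < i" "x = x div i * i + x mod i"
    using assms by (auto simp: less_mult_imp_div_less mult.commute)
qed

lemma map_permutation_block_permutes:
  assumes "\<pi> permutes {..<i}"
  shows "map_permutation {..<i} (\<lambda>m. k * i + m) \<pi> permutes {k * i..<Suc k * i}"
proof (rule map_permutation_permutes[OF _ assms])
  show "bij_betw (\<lambda>m. k * i + m) {..<i} {k * i..<Suc k * i}"
    by (rule bij_betw_byWitness[where f' = "\<lambda>x. x - k * i"]) auto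
qed

lemma block_perm_permutes:
  assumes "\<And>j. j < k \<Longrightarrow> p j permutes {..<i}"
  shows "block_perm i k p permutes {..<i * k}"
  using assms
proof (induction k)
  case (Suc k)
  have "block_perm i k p permutes {..<i * Suc k}"
    by (rule permutes_subset[OF Suc.IH]) (use Suc.prems in auto)
  moreover have "map_permutation {..<i} (\<lambda>m. k * i + m) (p k) permutes {..<i * Suc k}"
    by (rule permutes_subset[OF map_permutation_block_permutes])
      (use Suc.prems in \<open>auto simp: mult.commute\<close>)
  ultimately show ?case unfolding block_perm.simps by (rule permutes_compose[rotated])
qed (simp add: permutes_id)

lemma block_perm_apply:
  assumes "\<And>j. j < k \<Longrightarrow> p j permutes {..<i}" "j < k" "m < i"
  shows "block_perm i k p (j * i + m) = j * i + p j m"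
  using assms
proof (induction k)
  case (Suc k)
  show ?case
  proof (cases "j = k")
    case True
    have "map_permutation {..<i} (\<lambda>m. k * i + m) (p k) (k * i + m) = k * i + p k m"
      using Suc.prems by (intro map_permutation_apply) (auto simp: inj_on_def)
    \<comment> \<open>The factors for the earlier blocks move only numbers below
      \<open>i * k\<close>.\<close>
    moreover have "block_perm i k p (k * i + p k m) = k * i + p k m"
      using Suc.prems by (intro permutes_not_in[OF block_perm_permutes]) (auto simp: mult.commute)
    ultimately show ?thesis using True by simp
  next
    case False
    then have j: "j < k" using Suc.prems by simp
    have "map_permutation {..<i} (\<lambda>m. k * i + m) (p k) (j * i + m) = j * i + m"
      using map_permutation_block_permutes[OF Suc.prems(1)[of k], of k]
        block_index_less[OF j Suc.prems(3)]
      by (intro permutes_not_in) (auto simp: mult.commute)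
    then show ?thesis using Suc j by simp
  qed
qed simp

lemma sign_block_perm:
  assumes "\<And>j. j < k \<Longrightarrow> p j permutes {..<i}"
  shows "sign (block_perm i k p) = (\<Prod>j<k. sign (p j))"
  using assms
proof (induction k)
  case (Suc k)
  have "permutation (block_perm i k p)"
    using Suc.prems by (intro permutes_imp_permutation[OF _ block_perm_permutes]) auto
  moreover have "permutation (map_permutation {..<i} (\<lambda>m. k * i + m) (p k))"
    using map_permutation_block_permutes[OF Suc.prems[of k], of k]
    by (intro permutes_imp_permutation) auto
  moreover have "sign (map_permutation {..<i} (\<lambda>m. k * i + m) (p k)) = sign (p k)"
    using Suc.prems by (intro sign_map_permutation) (auto simp: inj_on_def)
  ultimately show ?case using Suc by (simp add: sign_compose del: o_apply comp_apply flip: comp_def)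
qed simp

text \<open>These are the shuffles of type (i, ..., i), the standard representatives of the left
  cosets of the block-preserving subgroup.\<close>

definition block_increasing_perms :: "nat \<Rightarrow> nat \<Rightarrow> (nat \<Rightarrow> nat) set" where
  "block_increasing_perms i k =
     {\<sigma>. \<sigma> permutes {..<i * k} \<and> (\<forall>j<k. strict_mono_on {j * i..<Suc j * i} \<sigma>)}"

lemma block_increasing_permsD:
  assumes "\<sigma> \<in> block_increasing_perms i k"
  shows "\<sigma> permutes {..<i * k}" "j < k \<Longrightarrow> strict_mono_on {j * i..<Suc j * i} \<sigma>"
  using assms unfolding block_increasing_perms_def by blast+

text \<open>Extensional functions make a family determined by its members below \<open>k\<close>, as
  injectivity of the factorization requires.\<close>

abbreviation perm_families :: "nat \<Rightarrow> nat \<Rightarrow> (nat \<Rightarrow> nat \<Rightarrow> nat) set" where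
  "perm_families i k \<equiv> PiE {..<k} (\<lambda>_. {\<pi>. \<pi> permutes {..<i}})"

lemma sorted_wrt_block:
  assumes "strict_mono_on {j * i..<Suc j * i} (\<tau> :: nat \<Rightarrow> nat)"
  shows "sorted_wrt (<) (map \<tau> [j * i..<Suc j * i])"
  unfolding sorted_wrt_map
  by (rule sorted_wrt_mono_rel[OF _ sorted_wrt_upt]) (use assms in \<open>auto simp: strict_mono_on_def\<close>)

lemma strict_mono_on_block:
  assumes "sorted_wrt (<) (map (\<tau> :: nat \<Rightarrow> nat) [j * i..<Suc j * i])"
  shows "strict_mono_on {j * i..<Suc j * i} \<tau>"
proof (rule strict_mono_onI)
  fix r s assume "r \<in> {j * i..<Suc j * i}" "s \<in> {j * i..<Suc j * i}" "r < s"
  then show "\<tau> r < \<tau> s"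
    using sorted_wrt_nth_less[OF assms, of "r - j * i" "s - j * i"] by auto
qed

lemma sorting_permutation:
  fixes \<alpha> :: "'a :: linorder list"
  assumes "distinct \<alpha>"
  obtains \<pi> where "\<pi> permutes {..<length \<alpha>}" "sorted_wrt (<) (permute_list \<pi> \<alpha>)"
proof -
  have "mset (sort \<alpha>) = mset \<alpha>" by simp
  then obtain \<pi> where "\<pi> permutes {..<length \<alpha>}" "permute_list \<pi> \<alpha> = sort \<alpha>"
    by (rule mset_eq_permutation)
  then show thesis using that assms by (metis distinct_sort sorted_sort strict_sorted_iff)
qed

text \<open>For injectivity, the product determines the set of values on each block;
  \<open>\<tau>\<close> lists that set increasingly and is thus determined, and cancelling
  \<open>\<tau>\<close> recovers \<open>p\<close>. For surjectivity, the values of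
  \<open>\<sigma>\<close> are sorted within each block and the sorting is then undone.\<close>

lemma bij_betw_block_decomposition:
  "bij_betw (\<lambda>(\<tau>, p). \<tau> \<circ> block_perm i k p) (block_increasing_perms i k \<times> perm_families i k)
     {\<sigma>. \<sigma> permutes {..<i * k}}"
  (is "bij_betw ?f ?X ?Y")
proof (rule bij_betwI')
  fix x y assume "x \<in> ?X" "y \<in> ?X"
  then obtain \<tau> p \<tau>' p' where xy: "x = (\<tau>, p)" "y = (\<tau>', p')"
    and t: "\<tau> \<in> block_increasing_perms i k" "\<tau>' \<in> block_increasing_perms i k"
    and p: "p \<in> perm_families i k" "p' \<in> perm_families i k" by auto
  \<comment> \<open>Permuting positions inside a block does not change the set of values on it, so
    the values of \<open>\<tau>\<close> on a block can be read off from the product.\<close>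
  have img: "set (map \<tau> [j * i..<Suc j * i]) = (\<lambda>m. (\<tau> \<circ> block_perm i k p) (j * i + m)) ` {..<i}"
    if "p \<in> perm_families i k" "j < k" for \<tau> :: "nat \<Rightarrow> nat" and p j
  proof -
    have pj: "p j permutes {..<i}" using that by auto
    have "{j * i..<Suc j * i} = (\<lambda>m. j * i + m) ` {..<i}"
      using image_add_atLeastLessThan[of "j * i" 0 i] by (simp add: lessThan_atLeast0 add.commute)
    also have "\<dots> = (\<lambda>m. j * i + m) ` (p j ` {..<i})" using permutes_image[OF pj] by simp
    finally have "\<tau> ` {j * i..<Suc j * i} = (\<lambda>m. \<tau> (j * i + p j m)) ` {..<i}"
      by (simp add: image_image)
    also have "\<dots> = (\<lambda>m. (\<tau> \<circ> block_perm i k p) (j * i + m)) ` {..<i}"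
      using that by (intro image_cong refl) (auto simp: block_perm_apply PiE_iff)
    finally show ?thesis by simp
  qed
  show "?f x = ?f y \<longleftrightarrow> x = y"
  proof
    assume "?f x = ?f y"
    then have eq: "\<tau> \<circ> block_perm i k p = \<tau>' \<circ> block_perm i k p'" using xy by simp
    \<comment> \<open>Strictly increasing lists with the same elements are equal.\<close>
    have "map \<tau> [j * i..<Suc j * i] = map \<tau>' [j * i..<Suc j * i]" if "j < k" for j
    proof (rule strict_sorted_equal[symmetric])
      show "sorted_wrt (<) (map \<tau> [j * i..<Suc j * i])" "sorted_wrt (<) (map \<tau>' [j * i..<Suc j * i])"
        using t that by (blast intro: sorted_wrt_block dest: block_increasing_permsD)+
      show "set (map \<tau>' [j * i..<Suc j * i]) = set (map \<tau> [j * i..<Suc j * i])"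
        using img[OF p(1) that, where \<tau> = \<tau>] img[OF p(2) that, where \<tau> = \<tau>'] eq by simp
    qed
    then have b: "\<tau> x = \<tau>' x" if "j < k" "x \<in> {j * i..<Suc j * i}" for j x
      using that by (auto simp del: upt_Suc)
    have te: "\<tau> = \<tau>'"
    proof
      fix x
      show "\<tau> x = \<tau>' x"
      proof (cases "x < i * k")
        case True
        then obtain j m where "j < k" "m < i" "x = j * i + m" by (rule block_indexE)
        then show ?thesis using b[of j x] by auto
      next
        case False
        then show ?thesis
          using block_increasing_permsD(1)[OF t(1)] block_increasing_permsD(1)[OF t(2)]
          by (simp add: permutes_not_in)
      qed
    qed
    have "inj \<tau>" using t permutes_inj by (auto simp: block_increasing_perms_def)
    then have be: "block_perm i k p x = block_perm i k p' x" for x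
      using eq te by (auto simp: fun_eq_iff inj_eq)
    have "p = p'"
    proof (rule PiE_ext[OF p])
      fix j assume j: "j \<in> {..<k}"
      show "p j = p' j"
      proof
        fix m
        show "p j m = p' j m"
        proof (cases "m < i")
          case True
          moreover have "\<And>j. j < k \<Longrightarrow> p j permutes {..<i}" "\<And>j. j < k \<Longrightarrow> p' j permutes {..<i}"
            using p by auto
          ultimately show ?thesis using be[of "j * i + m"] j by (simp add: block_perm_apply)
        next
          case False
          then have "m \<notin> {..<i}" by simp
          moreover have "p j permutes {..<i}" "p' j permutes {..<i}" using p j by auto
          ultimately show ?thesis by (metis permutes_not_in)
        qed
      qed
    qed
    then show "x = y" using te xy by simp
  qed simp
next
  fix x assume "x \<in> ?X"
  then show "?f x \<in> ?Y"
    by (auto simp: block_increasing_perms_def PiE_iff intro!: permutes_compose block_perm_permutes)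
next
  fix \<sigma> assume "\<sigma> \<in> ?Y"
  then have s: "\<sigma> permutes {..<i * k}" by simp
  have "\<exists>\<pi>. \<pi> permutes {..<i} \<and> sorted_wrt (<) (permute_list \<pi> (map \<sigma> [j * i..<Suc j * i]))" for j
  proof -
    have "distinct (map \<sigma> [j * i..<Suc j * i])"
      using permutes_inj_on[OF s] by (simp add: distinct_map del: upt_Suc)
    from sorting_permutation[OF this] show ?thesis by (auto simp del: upt_Suc)
  qed
  then obtain p where p: "\<And>j. p j permutes {..<i}"
    "\<And>j. sorted_wrt (<) (permute_list (p j) (map \<sigma> [j * i..<Suc j * i]))" by metis
  \<comment> \<open>The sorting permutations \<open>p j\<close> turn \<open>\<sigma>\<close> into
    the increasing factor, so the block-preserving factor consists of their inverses, restricted to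
    \<open>{..<k}\<close> to be extensional.\<close>
  define q where "q = restrict (\<lambda>j. inv_into UNIV (p j)) {..<k}"
  have q: "q \<in> perm_families i k" "\<And>j. j < k \<Longrightarrow> q j permutes {..<i}"
    using p by (auto simp: q_def permutes_inv)
  define \<tau> where "\<tau> = \<sigma> \<circ> block_perm i k p"
  have "strict_mono_on {j * i..<Suc j * i} \<tau>" if j: "j < k" for j
  proof (rule strict_mono_on_block)
    have "map \<tau> [j * i..<Suc j * i] = permute_list (p j) (map \<sigma> [j * i..<Suc j * i])"
    proof (rule nth_equalityI)
      fix m assume "m < length (map \<tau> [j * i..<Suc j * i])"
      then have m: "m < i" by simp
      moreover have "p j m < i" using m p(1)[of j] by (metis lessThan_iff permutes_in_image)
      ultimately show "map \<tau> [j * i..<Suc j * i] ! m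
          = permute_list (p j) (map \<sigma> [j * i..<Suc j * i]) ! m"
        using p(1) j by (simp add: permute_list_nth \<tau>_def block_perm_apply del: upt_Suc)
    qed simp
    then show "sorted_wrt (<) (map \<tau> [j * i..<Suc j * i])" using p(2)[of j] by simp
  qed
  moreover have "\<tau> permutes {..<i * k}"
    unfolding \<tau>_def using p s by (intro permutes_compose block_perm_permutes) auto
  ultimately have t: "\<tau> \<in> block_increasing_perms i k" by (simp add: block_increasing_perms_def)
  have "block_perm i k p (block_perm i k q x) = x" for x
  proof (cases "x < i * k")
    case True
    then obtain j m where jm: "j < k" "m < i" "x = j * i + m" by (rule block_indexE)
    have "q j m < i" using q(2) jm by (metis lessThan_iff permutes_in_image)
    moreover have "p j (q j m) = m" using p(1)[of j] jm by (simp add: q_def permutes_inverses)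
    ultimately show ?thesis using p q jm by (simp add: block_perm_apply)
  next
    case False
    moreover have "block_perm i k p permutes {..<i * k}" "block_perm i k q permutes {..<i * k}"
      using p q by (auto intro!: block_perm_permutes)
    ultimately show ?thesis by (simp add: permutes_not_in)
  qed
  then have "\<sigma> = ?f (\<tau>, q)" by (auto simp: \<tau>_def fun_eq_iff)
  then show "\<exists>x\<in>?X. \<sigma> = ?f x" using t q by blast
qed

lemma sum_permutations_block_decomposition:
  fixes f :: "(nat \<Rightarrow> nat) \<Rightarrow> 'b :: comm_monoid_add"
  shows "(\<Sum>\<sigma> | \<sigma> permutes {..<i * k}. f \<sigma>)
    = (\<Sum>\<tau>\<in>block_increasing_perms i k. \<Sum>p\<in>perm_families i k. f (\<tau> \<circ> block_perm i k p))"
  using sum.reindex_bij_betw[OF bij_betw_block_decomposition, of f i k]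
  by (simp add: sum.cartesian_product case_prod_unfold)

section \<open>Laplace expansion along blocks of rows\<close>

lemma prod_blocks:
  fixes f :: "nat \<Rightarrow> 'b :: comm_monoid_mult"
  shows "(\<Prod>x<i * k. f x) = (\<Prod>j<k. \<Prod>m<i. f (j * i + m))"
proof -
  have "(\<Prod>m<i. f (j * i + m)) = prod f {j * i..<j * i + i}" for j
    using prod.shift_bounds_nat_ivl[of f 0 "j * i" i] by (simp add: lessThan_atLeast0 add.commute)
  then show ?thesis using prod.nat_group[of f i k] by (simp add: mult.commute)
qed

lemma sign_compose_block_perm:
  assumes "\<tau> permutes {..<i * k}" "p \<in> perm_families i k"
  shows "sign (\<tau> \<circ> block_perm i k p) = sign \<tau> * (\<Prod>j<k. sign (p j))"
proof -
  have p: "\<And>j. j < k \<Longrightarrow> p j permutes {..<i}" using assms by auto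
  then have "sign (\<tau> \<circ> block_perm i k p) = sign \<tau> * sign (block_perm i k p)"
    using assms(1) block_perm_permutes[of k p i]
    by (intro sign_compose) (auto intro: permutes_imp_permutation[OF finite_lessThan])
  then show ?thesis using p sign_block_perm by simp
qed

text \<open>The Leibniz sum is grouped by cosets: \<open>\<tau>\<close> decides which columns go to
  which block of rows, and summing over the rearrangements inside the blocks gives one Leibniz sum,
  hence one determinant, per block.\<close>

lemma det_laplace_blocks:
  fixes C :: "nat \<Rightarrow> nat \<Rightarrow> 'a :: comm_ring_1"
  shows "det (mat (i * k) (i * k) (\<lambda>(a, b). C a b))
    = (\<Sum>\<tau>\<in>block_increasing_perms i k. of_int (sign \<tau>) *
        (\<Prod>j<k. det (mat i i (\<lambda>(a, b). C (j * i + a) (\<tau> (j * i + b))))))"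
proof -
  have d: "det (mat r r (\<lambda>(a, b). D a b))
      = (\<Sum>\<sigma> | \<sigma> permutes {..<r}. of_int (sign \<sigma>) * (\<Prod>x<r. D x (\<sigma> x)))"
    for r and D :: "nat \<Rightarrow> nat \<Rightarrow> 'a"
  proof -
    have "mat r r (\<lambda>(a, b). D a b) $$ (x, \<sigma> x) = D x (\<sigma> x)"
      if "\<sigma> permutes {0..<r}" "x < r" for \<sigma> x
      using that permutes_in_image[OF that(1), of x] by simp
    then show ?thesis
      by (subst det_def'[of _ r]) (auto simp: lessThan_atLeast0 intro!: sum.cong prod.cong)
  qed
  \<comment> \<open>Sign and entries both split over the blocks, so the factor for block
    \<open>j\<close> depends on \<open>p\<close> only through \<open>p j\<close>. This is what
    allows the sum over families to be turned into a product of sums.\<close>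
  have "of_int (sign (\<tau> \<circ> block_perm i k p)) * (\<Prod>x<i * k. C x ((\<tau> \<circ> block_perm i k p) x))
      = of_int (sign \<tau>) * (\<Prod>j<k. of_int (sign (p j)) * (\<Prod>m<i. C (j * i + m) (\<tau> (j * i + p j m))))"
    if "\<tau> \<in> block_increasing_perms i k" "p \<in> perm_families i k" for \<tau> p
  proof -
    have "(\<Prod>x<i * k. C x ((\<tau> \<circ> block_perm i k p) x))
        = (\<Prod>j<k. \<Prod>m<i. C (j * i + m) (\<tau> (j * i + p j m)))"
      unfolding prod_blocks using that
      by (intro prod.cong refl) (auto simp: block_perm_apply PiE_iff)
    then show ?thesis
      using that sign_compose_block_perm[of \<tau> i k p]
      by (simp add: block_increasing_perms_def prod.distrib mult.assoc)
  qed
  then show ?thesis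
    unfolding d sum_permutations_block_decomposition
    by (subst prod_sum_PiE) (auto simp: sum_distrib_left finite_permutations intro!: sum.cong)
qed

section \<open>Increasing families and the minors of tensor maps\<close>

lemma permuted_block_nth:
  "m < i \<Longrightarrow> permuted_block i \<sigma> J j ! m = concat J ! \<sigma> (j * i + m)"
  by (simp add: permuted_block_def del: upt_Suc)

lemma length_permuted_block [simp]: "length (permuted_block i \<sigma> J j) = i"
  by (simp add: permuted_block_def)

lemma length_concat_uniform:
  assumes "\<And>\<alpha>. \<alpha> \<in> set I \<Longrightarrow> length \<alpha> = i"
  shows "length (concat I) = i * length I"
  using assms by (induction I) auto

lemma concat_nth_uniform:
  assumes "\<And>\<alpha>. \<alpha> \<in> set I \<Longrightarrow> length \<alpha> = i" "j < length I" "m < i"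
  shows "concat I ! (j * i + m) = I ! j ! m"
  using assms
proof (induction I arbitrary: j)
  case (Cons \<alpha> I)
  then show ?case by (cases j) (auto simp: nth_append)
qed simp

lemma increasing_familyD:
  assumes "increasing_family n i k I"
  shows "length (concat I) = i * k" "sorted_wrt (<) (concat I)" "set (concat I) \<subseteq> {..<n}"
    "\<And>j. j < k \<Longrightarrow> I ! j \<in> index_tuples n i"
    "\<And>j. j < k \<Longrightarrow> sorted_wrt (<) (I ! j)"
    "\<And>j m. j < k \<Longrightarrow> m < i \<Longrightarrow> concat I ! (j * i + m) = I ! j ! m"
proof -
  have k: "length I = k" and t: "\<And>\<alpha>. \<alpha> \<in> set I \<Longrightarrow> \<alpha> \<in> index_tuples n i"
    and s: "sorted_wrt (<) (concat I)"
    using assms by (auto simp: increasing_family_def)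
  have l: "\<And>\<alpha>. \<alpha> \<in> set I \<Longrightarrow> length \<alpha> = i" using t by (auto simp: index_tuples_def)
  show len: "length (concat I) = i * k" using length_concat_uniform l k by blast
  show "sorted_wrt (<) (concat I)" by (rule s)
  show "set (concat I) \<subseteq> {..<n}" using t by (auto simp: index_tuples_def)
  show nt: "I ! j \<in> index_tuples n i" if "j < k" for j using that t k by simp
  show c: "concat I ! (j * i + m) = I ! j ! m" if "j < k" "m < i" for j m
    using concat_nth_uniform[of I i j m] that l k by simp
  show "sorted_wrt (<) (I ! j)" if j: "j < k" for j
  proof -
    have "length (I ! j) = i" using nt[OF j] by (simp add: index_tuples_def)
    moreover have "I ! j ! a < I ! j ! b" if "a < b" "b < i" for a b
      using sorted_wrt_nth_less[OF s, of "j * i + a" "j * i + b"] that c[OF j, of a] c[OF j, of b]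
        block_index_less[OF j that(2)] len by simp
    ultimately show ?thesis by (simp add: sorted_wrt_iff_nth_less)
  qed
qed

lemma permuted_block_in_index_tuples:
  assumes "increasing_family n i k J" "\<sigma> permutes {..<i * k}" "j < k"
  shows "permuted_block i \<sigma> J j \<in> index_tuples n i"
proof -
  have "permuted_block i \<sigma> J j ! m < n" if "m < i" for m
  proof -
    have "\<sigma> (j * i + m) < i * k"
      using block_index_less[OF assms(3) that] permutes_in_image[OF assms(2)] by blast
    then show ?thesis
      using that increasing_familyD(1,3)[OF assms(1)] nth_mem[of "\<sigma> (j * i + m)" "concat J"]
      by (simp add: permuted_block_nth subset_eq del: set_concat)
  qed
  then show ?thesis by (auto simp: index_tuples_def in_set_conv_nth)
qed

text \<open>Replacing \<open>\<tau>\<close> by another member of its coset produces each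
  \<open>sign (p j)\<close> twice, once from the sign of the permutation and once from antisymmetry
  in the inputs. The signs cancel, so every term is repeated once for each family
  \<open>p\<close>.\<close>

lemma tensor_minor_antisymmetric:
  fixes c :: "nat list \<Rightarrow> nat list \<Rightarrow> 'a :: comm_ring_1"
  assumes I: "increasing_family n i k I" and J: "increasing_family n i k J"
  defines "T \<equiv> tensor_map n i (antisym_extension i c)"
  shows "tensor_minor n i k T I J = of_nat (fact i) ^ k * reduced_tensor_minor n i k T I J"
proof -
  have "minor_term n i k T I J (\<tau> \<circ> block_perm i k p) = minor_term n i k T I J \<tau>"
    if t: "\<tau> permutes {..<i * k}" and p: "p \<in> perm_families i k" for \<tau> p
  proof -
    have pj: "\<And>j. j < k \<Longrightarrow> p j permutes {..<i}" using p by auto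
    have tp: "(\<tau> \<circ> block_perm i k p) permutes {..<i * k}"
      using t pj by (intro permutes_compose block_perm_permutes)
    have "tensor_coeff n i T (I ! j) (permuted_block i (\<tau> \<circ> block_perm i k p) J j)
        = of_int (sign (p j)) * tensor_coeff n i T (I ! j) (permuted_block i \<tau> J j)"
      if j: "j < k" for j
    proof -
      \<comment> \<open>The block-preserving factor acts first: it rearranges positions inside block
        \<open>j\<close> before \<open>\<tau>\<close> selects the entries of
        \<open>J\<close>.\<close>
      have b: "permuted_block i (\<tau> \<circ> block_perm i k p) J j
          = permute_list (p j) (permuted_block i \<tau> J j)"
      proof (rule nth_equalityI)
        fix m assume "m < length (permuted_block i (\<tau> \<circ> block_perm i k p) J j)"
        then have m: "m < i" by simp
        moreover have "p j m < i" using m pj[OF j] by (metis lessThan_iff permutes_in_image)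
        ultimately show "permuted_block i (\<tau> \<circ> block_perm i k p) J j ! m
            = permute_list (p j) (permuted_block i \<tau> J j) ! m"
          using pj j by (simp add: permute_list_nth permuted_block_nth block_perm_apply)
      qed simp
      show ?thesis
        unfolding T_def
        using increasing_familyD(4)[OF I j] permuted_block_in_index_tuples[OF J t j]
          permuted_block_in_index_tuples[OF J tp j]
        by (simp add: tensor_coeff_tensor_map b antisym_extension_permute_right[OF pj[OF j]])
    qed
    then have "minor_term n i k T I J (\<tau> \<circ> block_perm i k p)
        = of_int (sign \<tau> * (\<Prod>j<k. sign (p j)) * (\<Prod>j<k. sign (p j)))
          * (\<Prod>j<k. tensor_coeff n i T (I ! j) (permuted_block i \<tau> J j))"
      using sign_compose_block_perm[OF t p] by (simp add: minor_term_def prod.distrib ac_simps)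
    also have "sign \<tau> * (\<Prod>j<k. sign (p j)) * (\<Prod>j<k. sign (p j)) = sign \<tau>"
      by (simp add: mult.assoc flip: prod.distrib)
    finally show ?thesis by (simp only: minor_term_def)
  qed
  then have "tensor_minor n i k T I J = (\<Sum>\<tau>\<in>block_increasing_perms i k.
      \<Sum>p\<in>perm_families i k. minor_term n i k T I J \<tau>)"
    unfolding tensor_minor_def sum_permutations_block_decomposition
    by (intro sum.cong refl) (auto simp: block_increasing_perms_def)
  also have "\<dots> = of_nat (card (perm_families i k)) * reduced_tensor_minor n i k T I J"
    by (simp add: reduced_tensor_minor_def block_increasing_perms_def sum_distrib_left)
  also have "card (perm_families i k) = fact i ^ k"
    by (simp add: card_PiE card_permutations)
  finally show ?thesis by simp
qed

text \<open>Every tuple occurring in the reduced minor is increasing, so each coefficient is a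
  cofactor with no extra sign. Jacobi's identity supplies one factor \<open>det A\<close> per block,
  and the remaining minors of \<open>B\<close> form a Laplace expansion.\<close>

lemma reduced_tensor_minor_adjugate:
  fixes A B :: "'a :: comm_ring_1 mat"
  assumes A: "A \<in> carrier_mat n n" and B: "B \<in> carrier_mat n n" and AB: "A * B = 1\<^sub>m n"
    and I: "increasing_family n i k I" and J: "increasing_family n i k J"
  shows "reduced_tensor_minor n i k (adjugate n i A) I J
    = det A ^ k * det (mat (i * k) (i * k) (\<lambda>(a, b). B $$ (concat I ! a, concat J ! b)))"
proof -
  have "minor_term n i k (adjugate n i A) I J \<tau> = det A ^ k * (of_int (sign \<tau>) *
      (\<Prod>j<k. det (mat i i (\<lambda>(a, b). B $$ (concat I ! (j * i + a), concat J ! \<tau> (j * i + b))))))"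
    if "\<tau> \<in> block_increasing_perms i k" for \<tau>
  proof -
    have t: "\<tau> permutes {..<i * k}" using that by (simp add: block_increasing_perms_def)
    have "tensor_coeff n i (adjugate n i A) (I ! j) (permuted_block i \<tau> J j) = det A *
        det (mat i i (\<lambda>(a, b). B $$ (concat I ! (j * i + a), concat J ! \<tau> (j * i + b))))"
      if j: "j < k" for j
    proof -
      let ?\<beta> = "permuted_block i \<tau> J j"
      have It: "I ! j \<in> index_tuples n i" by (rule increasing_familyD(4)[OF I j])
      have bt: "?\<beta> \<in> index_tuples n i" by (rule permuted_block_in_index_tuples[OF J t j])
      have Is: "sorted_wrt (<) (I ! j)" by (rule increasing_familyD(5)[OF I j])
      have "strict_mono_on {j * i..<Suc j * i} \<tau>"
        using \<open>\<tau> \<in> block_increasing_perms i k\<close> j by (simp add: block_increasing_perms_def)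
      \<comment> \<open>The permuted block is increasing because \<open>\<tau>\<close> is increasing
        on block \<open>j\<close> and \<open>concat J\<close> is increasing as a whole.\<close>
      then have "\<tau> (j * i + a) < \<tau> (j * i + b)" if "a < b" "b < i" for a b
        using that by (auto simp: strict_mono_on_def)
      moreover have "\<tau> (j * i + b) < length (concat J)" if "b < i" for b
        using block_index_less[OF j that] permutes_in_image[OF t] increasing_familyD(1)[OF J] by auto
      ultimately have bs: "sorted_wrt (<) ?\<beta>"
        using increasing_familyD(2)[OF J]
        by (auto simp: sorted_wrt_iff_nth_less permuted_block_nth)
      have "tensor_coeff n i (adjugate n i A) (I ! j) ?\<beta> = gen_cofactor A ?\<beta> (I ! j)"
        using It bt Is bs
        by (simp add: adjugate_def tensor_coeff_tensor_map antisym_extension_ordered index_tuples_def)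
      also have "\<dots> = det A * det (mat i i (\<lambda>(a, b). B $$ (I ! j ! a, ?\<beta> ! b)))"
        using It bt Is bs
        by (intro gen_cofactor_eq_minor_inverse[OF A B AB]) (auto simp: index_tuples_def)
      also have "mat i i (\<lambda>(a, b). B $$ (I ! j ! a, ?\<beta> ! b))
          = mat i i (\<lambda>(a, b). B $$ (concat I ! (j * i + a), concat J ! \<tau> (j * i + b)))"
        using increasing_familyD(6)[OF I j] by (intro eq_matI) (auto simp: permuted_block_nth)
      finally show ?thesis .
    qed
    then show ?thesis by (simp add: minor_term_def prod.distrib ac_simps)
  qed
  then show ?thesis
    unfolding reduced_tensor_minor_def det_laplace_blocks sum_distrib_left
      block_increasing_perms_def[symmetric]
    by (rule sum.cong[OF refl])
qed

theorem theorem9p2: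
  fixes A :: "'a :: field mat" and n i k :: nat and I J :: "nat list list"
  assumes "n \<ge> 2"
    and "A \<in> carrier_mat n n" and "invertible_mat A"
    and "i \<le> n" and "k > 0" and "i * k \<le> n"
    and "increasing_family n i k I" and "increasing_family n i k J"
  shows "reduced_tensor_minor n i k (adjugate n i A) I J
           = gen_cofactor A (concat J) (concat I) * det A ^ (k - 1)
       \<and> tensor_minor n i k (adjugate n i A) I J
           = of_nat (fact i) ^ k * (gen_cofactor A (concat J) (concat I) * det A ^ (k - 1))"
proof -
  note A = assms(2) and I = assms(7) and J = assms(8)
  obtain B where AB: "A * B = 1\<^sub>m n" and BA: "B * A = 1\<^sub>m (dim_row B)"
    using assms(2,3) by (auto simp: invertible_mat_def inverts_mat_def)
  \<comment> \<open>The column count of \<open>A * B\<close> gives the columns of \<open>B\<close>,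
    and that of \<open>B * A\<close> gives its rows.\<close>
  have B: "B \<in> carrier_mat n n"
    using arg_cong[OF AB, of dim_col] arg_cong[OF BA, of dim_col] A by auto
  have C: "gen_cofactor A (concat J) (concat I)
      = det A * det (mat (i * k) (i * k) (\<lambda>(a, b). B $$ (concat I ! a, concat J ! b)))"
    using increasing_familyD(1-3)[OF I] increasing_familyD(1-3)[OF J]
    by (intro gen_cofactor_eq_minor_inverse[OF A B AB])
  \<comment> \<open>As \<open>k > 0\<close>, one factor \<open>det A\<close> can be split off; by
    \<open>C\<close> it turns the minor of \<open>B\<close> into the cofactor of
    \<open>A\<close>.\<close>
  have "det A ^ k = det A * det A ^ (k - 1)"
    using assms(5) by (cases k) auto
  then have "reduced_tensor_minor n i k (adjugate n i A) I J
      = gen_cofactor A (concat J) (concat I) * det A ^ (k - 1)"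
    using reduced_tensor_minor_adjugate[OF A B AB I J] C by simp
  moreover have "tensor_minor n i k (adjugate n i A) I J
      = of_nat (fact i) ^ k * reduced_tensor_minor n i k (adjugate n i A) I J"
    unfolding adjugate_def by (rule tensor_minor_antisymmetric[OF I J])
  ultimately show ?thesis by simp
qed

end
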